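(* For each $a\in\mathbb{R}\cap\mathbb{D}$, the ideal $P_a=\ker(\mathrm{ev}_a)$ is a maximal ideal of $\mathcal{R}_{\mathbb{R}}$ with $\mathcal{R}_{\mathbb{R}}/P_a\cong\mathbb{R}$.
   Context: $\mathbb{D}=\{z\in\mathbb{C}:|z|<1\}$ is the open unit disk and $\mathcal{O}(\mathbb{D})$ is the ring of holomorphic functions on $\mathbb{D}$. $\mathcal{R}_{\mathbb{R}}=\mathbb{Z}[[z]]\cap\mathcal{O}(\mathbb{D})$ is the ring of holomorphic functions on $\mathbb{D}$ all of whose Taylor coefficients at $0$ are integers. For $a\in\mathbb{D}$, $\mathrm{ev}_a:\mathcal{R}_{\mathbb{R}}\to\mathbb{C}$ is the evaluation map $f\mapsto f(a)$.
   Formalization: The formal statement assumes a is nonzero; at a = 0 the claim fails, since f(0) is the constant Taylor coefficient, so the quotient by P_0 is the ring of integers and P_0 is not maximal. *)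

theory Defs
  imports
    "HOL-Complex_Analysis.Complex_Analysis"
    "HOL-Algebra.QuotRing"
    "HOL-Algebra.Algebraic_Closure_Type"
begin

abbreviation unit_disk :: "complex set" where
  "unit_disk \<equiv> ball 0 1"

text \<open>A function on the disk is represented by an extensional total function, so that equality in
  the carrier is equality of functions on the disk. Values off the disk play no role in
  holomorphy, since the disk is open.\<close>

definition holo_ring :: "(complex \<Rightarrow> complex) ring" where
  "holo_ring =
    \<lparr>carrier = {f \<in> extensional unit_disk. f holomorphic_on unit_disk},
     monoid.mult = (\<lambda>f g. \<lambda>z\<in>unit_disk. f z * g z),
     one = (\<lambda>z\<in>unit_disk. 1),
     ring.zero = (\<lambda>z\<in>unit_disk. 0),
     add = (\<lambda>f g. \<lambda>z\<in>unit_disk. f z + g z)\<rparr>"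

definition int_holo_ring :: "(complex \<Rightarrow> complex) ring" where
  "int_holo_ring =
    holo_ring\<lparr>carrier := {f \<in> carrier holo_ring. \<forall>n. fps_nth (fps_expansion f 0) n \<in> \<int>}\<rparr>"

definition ev :: "complex \<Rightarrow> (complex \<Rightarrow> complex) \<Rightarrow> complex" where
  "ev a f = f a"

text \<open>The evaluation map is regarded as a map from \<open>int_holo_ring\<close> to the field of complex numbers.
  Note that its kernel at \<open>a = 0\<close> is not maximal: \<open>f 0\<close> is the constant Taylor
  coefficient, so the image of \<open>ev 0\<close> is the ring of integers.\<close>

definition ev_ker :: "complex \<Rightarrow> (complex \<Rightarrow> complex) set" where
  "ev_ker a = a_kernel int_holo_ring (ring_of_type_algebra :: complex ring) (ev a)"

end

theory Submission
  imports Defs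
begin

text \<open>
  An integer power series takes real values at a real point, so evaluation at \<open>a\<close> may be
  regarded as a ring homomorphism from the ring of holomorphic functions with integer Taylor
  coefficients to \<open>\<real>\<close>, with the same kernel as \<^const>\<open>ev\<close>. By the first isomorphism theorem and
  the fact that the kernel of a homomorphism onto a field is maximal, everything reduces to
  surjectivity: every real \<open>x\<close> must be of the form \<open>\<Sum>n. c n * a ^ n\<close> with integers \<open>c n\<close> whose
  power series converges on the whole disk.

  Such a series is an expansion of \<open>x\<close> in the real base \<open>1 / a\<close>, found by a
  greedy algorithm (lemma \<open>expansion_sums\<close>): split off the integer part of the current remainder as
  the next digit and divide the fractional part by \<open>a\<close>. Since fractional parts lie in \<open>[0, 1)\<close>,
  all remainders after the first are bounded by \<open>1 / \<bar>a\<bar>\<close>. Hence the digits are bounded, which makes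
  the radius of convergence at least \<open>1\<close>, and the error \<open>a ^ n\<close> times the \<open>n\<close>-th remainder tends to
  \<open>0\<close>. Only \<open>\<bar>a\<bar>\<close> enters these bounds, so no separate alternating expansion is needed for negative
  \<open>a\<close>; at \<open>a = 0\<close> the division breaks down, and indeed evaluation there has image \<open>\<int>\<close>.
\<close>

section \<open>Expansions of real numbers in real bases\<close>

primrec remainder :: "real \<Rightarrow> real \<Rightarrow> nat \<Rightarrow> real" where
  "remainder a x 0 = x"
| "remainder a x (Suc n) = frac (remainder a x n) / a"

definition digit :: "real \<Rightarrow> real \<Rightarrow> nat \<Rightarrow> int" where
  "digit a x n = \<lfloor>remainder a x n\<rfloor>"

lemma abs_remainder_le: "\<bar>remainder a x n\<bar> \<le> \<bar>x\<bar> + 1 / \<bar>a\<bar>"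
proof (cases n)
  case (Suc m)
  have "\<bar>frac (remainder a x m)\<bar> \<le> 1"
    using frac_lt_1[of "remainder a x m"] frac_ge_0[of "remainder a x m"] by linarith
  then have "\<bar>remainder a x n\<bar> \<le> 1 / \<bar>a\<bar>"
    by (simp add: Suc abs_divide divide_right_mono)
  then show ?thesis by linarith
qed simp

lemma abs_digit_le: "\<bar>real_of_int (digit a x n)\<bar> \<le> \<bar>x\<bar> + 1 / \<bar>a\<bar> + 1"
  unfolding digit_def using abs_remainder_le[of a x n] by linarith

lemma expansion_partial_sum:
  assumes "a \<noteq> 0"
  shows "(\<Sum>k<n. real_of_int (digit a x k) * a ^ k) = x - a ^ n * remainder a x n"
  using assms by (induction n) (simp_all add: digit_def frac_def algebra_simps)

lemma expansion_sums:
  assumes "a \<noteq> 0" "\<bar>a\<bar> < 1"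
  shows "(\<lambda>n. real_of_int (digit a x n) * a ^ n) sums x"
proof -
  have "(\<lambda>n. a ^ n * remainder a x n) \<longlonglongrightarrow> 0"
  proof (rule Lim_null_comparison)
    show "\<forall>\<^sub>F n in sequentially.
        norm (a ^ n * remainder a x n) \<le> \<bar>a\<bar> ^ n * (\<bar>x\<bar> + 1 / \<bar>a\<bar>)"
      by (simp add: abs_mult power_abs mult_left_mono abs_remainder_le)
    show "(\<lambda>n. \<bar>a\<bar> ^ n * (\<bar>x\<bar> + 1 / \<bar>a\<bar>)) \<longlonglongrightarrow> 0"
      using assms by (intro tendsto_mult_left_zero LIMSEQ_power_zero) simp
  qed
  then have "(\<lambda>n. x - a ^ n * remainder a x n) \<longlonglongrightarrow> x - 0"
    by (intro tendsto_intros)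
  then show ?thesis
    by (simp add: sums_def expansion_partial_sum[OF assms(1)])
qed

lemma fps_conv_radius_ge_1_if_bounded:
  fixes F :: "complex fps"
  assumes "\<And>n. norm (fps_nth F n) \<le> B"
  shows "fps_conv_radius F \<ge> 1"
  unfolding fps_conv_radius_def
proof (rule conv_radius_geI_ex')
  fix r :: real assume r: "0 < r" "ereal r < 1"
  have "summable (\<lambda>n. B * r ^ n)"
    using r by (intro summable_mult summable_geometric) simp
  then show "summable (\<lambda>n. fps_nth F n * of_real r ^ n)"
    by (rule summable_comparison_test')
       (use r assms in \<open>auto simp: norm_mult norm_power intro!: mult_right_mono\<close>)
qed

section \<open>The ring of holomorphic functions with integer Taylor coefficients\<close>

lemma int_holo_ring_simps:
  "f \<otimes>\<^bsub>int_holo_ring\<^esub> g = (\<lambda>z\<in>unit_disk. f z * g z)"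
  "f \<oplus>\<^bsub>int_holo_ring\<^esub> g = (\<lambda>z\<in>unit_disk. f z + g z)"
  "\<one>\<^bsub>int_holo_ring\<^esub> = (\<lambda>z\<in>unit_disk. 1)"
  "\<zero>\<^bsub>int_holo_ring\<^esub> = (\<lambda>z\<in>unit_disk. 0)"
  by (simp_all add: int_holo_ring_def holo_ring_def)

text \<open>Passing through \<^const>\<open>has_fps_expansion\<close> turns the closure properties of the carrier into
  those of formal power series with integer coefficients, which avoids the Leibniz rule for
  the higher derivatives in \<^const>\<open>fps_expansion\<close>.\<close>

lemma restrict_in_int_holo_ring:
  assumes "f holomorphic_on unit_disk" "f has_fps_expansion F" "\<And>n. fps_nth F n \<in> \<int>"
  shows "restrict f unit_disk \<in> carrier int_holo_ring"
proof -
  have "\<forall>\<^sub>F z in nhds 0. z \<in> unit_disk"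
    by (intro eventually_nhds_in_open) auto
  then have "\<forall>\<^sub>F z in nhds 0. restrict f unit_disk z = f z"
    by eventually_elim simp
  then have "restrict f unit_disk has_fps_expansion F"
    using assms(2) has_fps_expansion_cong by blast
  then have "fps_expansion (restrict f unit_disk) 0 = F"
    by (rule fps_expansion_eqI)
  moreover have "restrict f unit_disk holomorphic_on unit_disk"
    using assms(1) by (rule holomorphic_transform) simp
  ultimately show ?thesis
    using assms(3) by (simp add: int_holo_ring_def holo_ring_def)
qed

lemma int_holo_ringE:
  assumes "f \<in> carrier int_holo_ring"
  obtains F where "f holomorphic_on unit_disk" "f has_fps_expansion F" "\<forall>n. fps_nth F n \<in> \<int>"
proof -
  have "f holomorphic_on unit_disk"
    using assms by (simp add: int_holo_ring_def holo_ring_def)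
  then have "f has_fps_expansion fps_expansion f 0"
    by (intro has_fps_expansion_fps_expansion[of unit_disk]) auto
  then show thesis
    using assms that by (simp add: int_holo_ring_def holo_ring_def)
qed

lemma int_holo_ring_closed:
  assumes "f \<in> carrier int_holo_ring" "g \<in> carrier int_holo_ring"
  shows int_holo_ring_add: "(\<lambda>z\<in>unit_disk. f z + g z) \<in> carrier int_holo_ring"
    and int_holo_ring_mult: "(\<lambda>z\<in>unit_disk. f z * g z) \<in> carrier int_holo_ring"
proof -
  obtain F where F: "f holomorphic_on unit_disk" "f has_fps_expansion F" "\<forall>n. fps_nth F n \<in> \<int>"
    using assms(1) by (rule int_holo_ringE)
  obtain G where G: "g holomorphic_on unit_disk" "g has_fps_expansion G" "\<forall>n. fps_nth G n \<in> \<int>"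
    using assms(2) by (rule int_holo_ringE)
  show "(\<lambda>z\<in>unit_disk. f z + g z) \<in> carrier int_holo_ring"
    by (rule restrict_in_int_holo_ring[of _ "F + G"])
       (use F G in \<open>auto intro!: holomorphic_intros fps_expansion_intros\<close>)
  show "(\<lambda>z\<in>unit_disk. f z * g z) \<in> carrier int_holo_ring"
    by (rule restrict_in_int_holo_ring[of _ "F * G"])
       (use F G in \<open>auto simp: fps_mult_nth intro!: holomorphic_intros fps_expansion_intros\<close>)
qed

lemma int_holo_ring_uminus:
  assumes "f \<in> carrier int_holo_ring"
  shows "(\<lambda>z\<in>unit_disk. - f z) \<in> carrier int_holo_ring"
proof -
  obtain F where F: "f holomorphic_on unit_disk" "f has_fps_expansion F" "\<forall>n. fps_nth F n \<in> \<int>"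
    using assms by (rule int_holo_ringE)
  show ?thesis
    by (rule restrict_in_int_holo_ring[of _ "- F"])
       (use F in \<open>auto intro!: holomorphic_intros fps_expansion_intros\<close>)
qed

lemma int_holo_ring_zero: "(\<lambda>z\<in>unit_disk. 0) \<in> carrier int_holo_ring"
  by (rule restrict_in_int_holo_ring[of _ 0]) (auto intro!: fps_expansion_intros)

lemma int_holo_ring_one: "(\<lambda>z\<in>unit_disk. 1) \<in> carrier int_holo_ring"
  by (rule restrict_in_int_holo_ring[of _ 1]) (auto intro!: fps_expansion_intros)

lemma int_holo_ring_extensional: "f \<in> carrier int_holo_ring \<Longrightarrow> restrict f unit_disk = f"
  by (simp add: extensional_restrict int_holo_ring_def holo_ring_def)

lemma cring_int_holo_ring: "cring int_holo_ring"
proof (rule cringI)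
  show "abelian_group int_holo_ring"
  proof (rule abelian_groupI)
    fix f assume f: "f \<in> carrier int_holo_ring"
    show "\<exists>g\<in>carrier int_holo_ring. g \<oplus>\<^bsub>int_holo_ring\<^esub> f = \<zero>\<^bsub>int_holo_ring\<^esub>"
      by (rule bexI[OF _ int_holo_ring_uminus[OF f]])
         (auto simp: int_holo_ring_simps restrict_def fun_eq_iff)
    have "(\<lambda>z\<in>unit_disk. (\<lambda>z\<in>unit_disk. 0) z + f z) = restrict f unit_disk"
      by (rule restrict_ext) simp
    then show "\<zero>\<^bsub>int_holo_ring\<^esub> \<oplus>\<^bsub>int_holo_ring\<^esub> f = f"
      by (simp only: int_holo_ring_simps int_holo_ring_extensional[OF f])
  qed (auto simp: int_holo_ring_simps int_holo_ring_add int_holo_ring_zero add_ac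
         intro!: restrict_ext)
  show "comm_monoid int_holo_ring"
  proof (rule comm_monoidI)
    fix f assume f: "f \<in> carrier int_holo_ring"
    have "(\<lambda>z\<in>unit_disk. (\<lambda>z\<in>unit_disk. 1) z * f z) = restrict f unit_disk"
      by (rule restrict_ext) simp
    then show "\<one>\<^bsub>int_holo_ring\<^esub> \<otimes>\<^bsub>int_holo_ring\<^esub> f = f"
      by (simp only: int_holo_ring_simps int_holo_ring_extensional[OF f])
  qed (auto simp: int_holo_ring_simps int_holo_ring_mult int_holo_ring_one mult_ac
         intro!: restrict_ext)
qed (auto simp: int_holo_ring_simps distrib_right intro!: restrict_ext)

section \<open>Evaluation at real points\<close>

lemma int_holo_ring_eval_real:
  assumes "f \<in> carrier int_holo_ring" "\<bar>t\<bar> < 1"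
  shows "f (of_real t) \<in> \<real>"
proof -
  obtain F where F: "f holomorphic_on unit_disk" "f has_fps_expansion F" "\<forall>n. fps_nth F n \<in> \<int>"
    using assms(1) by (rule int_holo_ringE)
  have "(\<lambda>n. fps_nth F n * of_real t ^ n) sums f (of_real t)"
    by (rule has_fps_expansion_imp_sums_complex[of _ _ 1])
       (use F assms(2) in \<open>auto simp: one_ereal_def\<close>)
  then have sums: "(\<lambda>n. Im (fps_nth F n * of_real t ^ n)) sums Im (f (of_real t))"
    by (rule sums_Im)
  have "fps_nth F n * of_real t ^ n \<in> \<real>" for n
    using F(3)[rule_format, of n] by (auto elim!: Ints_cases)
  then have "(\<lambda>n. Im (fps_nth F n * of_real t ^ n)) = (\<lambda>_. 0)"
    by (simp only: complex_is_Real_iff)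
  with sums have "(\<lambda>_. 0) sums Im (f (of_real t))"
    by simp
  then have "Im (f (of_real t)) = 0"
    using sums_zero sums_unique2 by blast
  then show ?thesis
    by (simp only: complex_is_Real_iff)
qed

lemma int_holo_ring_eval_surj:
  assumes "t \<noteq> 0" "\<bar>t\<bar> < 1"
  obtains f where "f \<in> carrier int_holo_ring" "f (of_real t) = of_real x"
proof -
  define F :: "complex fps" where "F = Abs_fps (\<lambda>n. of_int (digit t x n))"
  have "norm (fps_nth F n) \<le> \<bar>x\<bar> + 1 / \<bar>t\<bar> + 1" for n
    using abs_digit_le[of t x n] by (simp add: F_def)
  then have radius: "fps_conv_radius F \<ge> 1"
    by (rule fps_conv_radius_ge_1_if_bounded)
  have "restrict (eval_fps F) unit_disk \<in> carrier int_holo_ring"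
  proof (rule restrict_in_int_holo_ring)
    have "unit_disk \<subseteq> eball 0 (fps_conv_radius F)"
      using radius ball_eball_mono[of 1 "fps_conv_radius F" 0] by (simp add: one_ereal_def)
    then show "eval_fps F holomorphic_on unit_disk"
      by (rule holomorphic_on_eval_fps)
    have "fps_conv_radius F > 0"
      using radius by (rule less_le_trans[rotated]) simp
    then show "eval_fps F has_fps_expansion F"
      by (simp add: has_fps_expansion_def)
  qed (simp add: F_def)
  moreover have "restrict (eval_fps F) unit_disk (of_real t) = of_real x"
  proof -
    have "(\<lambda>n. of_real (of_int (digit t x n) * t ^ n) :: complex) sums of_real x"
      using expansion_sums[OF assms] by (rule sums_of_real)
    then have "(\<lambda>n. fps_nth F n * of_real t ^ n) sums of_real x"
      by (simp add: F_def)
    then show ?thesis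
      using assms(2) by (simp add: eval_fps_def sums_iff)
  qed
  ultimately show thesis ..
qed

section \<open>Kernels of homomorphisms onto fields\<close>

text \<open>An ideal strictly containing the kernel contains an element with non-zero image, and a
  multiple of it differs from \<open>1\<close> by an element of the kernel.\<close>

lemma maximalideal_kernel_of_surj_onto_field:
  assumes "ring_hom_ring R S h" "field S" "h ` carrier R = carrier S"
  shows "maximalideal (a_kernel R S h) R"
proof -
  interpret ring_hom_ring R S h by fact
  interpret S: field S by fact
  have mem: "x \<in> a_kernel R S h \<longleftrightarrow> x \<in> carrier R \<and> h x = \<zero>\<^bsub>S\<^esub>" for x
    unfolding a_kernel_def' by blast
  show ?thesis
  proof (rule maximalidealI)
    show "ideal (a_kernel R S h) R"
      by (rule kernel_is_ideal)
    show "carrier R \<noteq> a_kernel R S h"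
    proof
      assume "carrier R = a_kernel R S h"
      with R.one_closed have "\<one>\<^bsub>R\<^esub> \<in> a_kernel R S h"
        by blast
      then show False
        using mem S.one_not_zero by (metis hom_one)
    qed
    fix J assume J: "ideal J R" "a_kernel R S h \<subseteq> J" "J \<subseteq> carrier R"
    show "J = a_kernel R S h \<or> J = carrier R"
    proof (rule disjCI)
      assume "J \<noteq> carrier R"
      have "x \<in> a_kernel R S h" if x: "x \<in> J" for x
      proof (rule ccontr)
        assume nk: "x \<notin> a_kernel R S h"
        have xR: "x \<in> carrier R"
          using x J(3) by blast
        with nk have unit: "h x \<in> Units S"
          by (simp add: mem S.field_Units)
        then have "inv\<^bsub>S\<^esub> h x \<in> h ` carrier R"
          by (simp add: assms(3))
        then obtain y where y: "y \<in> carrier R" "h y = inv\<^bsub>S\<^esub> h x"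
          by auto
        have "h (x \<otimes>\<^bsub>R\<^esub> y) = \<one>\<^bsub>S\<^esub>"
          using xR y unit by simp
        then have "\<one>\<^bsub>R\<^esub> \<ominus>\<^bsub>R\<^esub> x \<otimes>\<^bsub>R\<^esub> y \<in> a_kernel R S h"
          using xR y(1) by (simp add: mem R.minus_eq S.r_neg)
        then have "\<one>\<^bsub>R\<^esub> \<ominus>\<^bsub>R\<^esub> x \<otimes>\<^bsub>R\<^esub> y \<in> J"
          using J(2) by blast
        moreover have "x \<otimes>\<^bsub>R\<^esub> y \<in> J"
          using J(1) x y(1) by (rule ideal.I_r_closed)
        ultimately have "(\<one>\<^bsub>R\<^esub> \<ominus>\<^bsub>R\<^esub> x \<otimes>\<^bsub>R\<^esub> y) \<oplus>\<^bsub>R\<^esub> x \<otimes>\<^bsub>R\<^esub> y \<in> J"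
          using J(1) by (simp add: additive_subgroup.a_closed ideal.axioms(1))
        moreover have "(\<one>\<^bsub>R\<^esub> \<ominus>\<^bsub>R\<^esub> x \<otimes>\<^bsub>R\<^esub> y) \<oplus>\<^bsub>R\<^esub> x \<otimes>\<^bsub>R\<^esub> y = \<one>\<^bsub>R\<^esub>"
          using xR y(1) by (simp add: R.minus_eq R.a_assoc R.l_neg)
        ultimately have "J = carrier R"
          using J(1) ideal.one_imp_carrier by metis
        with \<open>J \<noteq> carrier R\<close> show False ..
      qed
      with J(2) show "J = a_kernel R S h" by blast
    qed
  qed
qed

section \<open>The kernel of evaluation at a real point\<close>

text \<open>The real part serves only to make \<open>\<real>\<close> the codomain as a type; it is multiplicative here
  because the values are real.\<close>

lemma ring_hom_ring_Re_eval:
  assumes "\<bar>t\<bar> < 1"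
  shows "ring_hom_ring int_holo_ring (ring_of_type_algebra :: real ring) (\<lambda>f. Re (f (of_real t)))"
proof (rule ring_hom_ringI)
  show "ring int_holo_ring"
    using cring_int_holo_ring by (rule cring.axioms(1))
  fix f g assume fg: "f \<in> carrier int_holo_ring" "g \<in> carrier int_holo_ring"
  have "Im (f (of_real t)) = 0" "Im (g (of_real t)) = 0"
    using fg assms int_holo_ring_eval_real by (simp_all add: complex_is_Real_iff)
  then show "Re ((f \<otimes>\<^bsub>int_holo_ring\<^esub> g) (of_real t)) =
      Re (f (of_real t)) \<otimes>\<^bsub>ring_of_type_algebra\<^esub> Re (g (of_real t))"
    using assms by (simp add: int_holo_ring_simps ring_of_type_algebra_def)
qed (rule ring_from_type_algebra,
     use assms in \<open>simp_all add: int_holo_ring_simps ring_of_type_algebra_def\<close>)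

lemma ev_ker_eq_kernel_Re_eval:
  assumes "\<bar>t\<bar> < 1"
  shows "ev_ker (of_real t) =
    a_kernel int_holo_ring (ring_of_type_algebra :: real ring) (\<lambda>f. Re (f (of_real t)))"
  using int_holo_ring_eval_real[OF _ assms]
  by (auto simp: ev_ker_def ev_def a_kernel_def' ring_of_type_algebra_def complex_eq_iff
        complex_is_Real_iff)

theorem proposition7p2:
  fixes a :: complex
  assumes "a \<in> \<real> \<inter> unit_disk"
    and "a \<noteq> 0"
  shows "maximalideal (ev_ker a) int_holo_ring
    \<and> int_holo_ring Quot ev_ker a \<simeq> (ring_of_type_algebra :: real ring)"
proof -
  obtain t where t: "a = of_real t" "t \<noteq> 0" "\<bar>t\<bar> < 1"
    using assms by (auto elim: Reals_cases)
  let ?h = "\<lambda>f::complex \<Rightarrow> complex. Re (f (of_real t))"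
  have hom: "ring_hom_ring int_holo_ring (ring_of_type_algebra :: real ring) ?h"
    using t(3) by (rule ring_hom_ring_Re_eval)
  have "x \<in> ?h ` carrier int_holo_ring" for x
    proof -
    obtain f where "f \<in> carrier int_holo_ring" "f (of_real t) = of_real x"
      using t(2,3) by (rule int_holo_ring_eval_surj)
    then show ?thesis
      by (intro image_eqI[of _ _ f]) simp_all
  qed
  then have surj: "?h ` carrier int_holo_ring = carrier (ring_of_type_algebra :: real ring)"
    by (auto simp: ring_of_type_algebra_def)
  show ?thesis
    unfolding t(1) ev_ker_eq_kernel_Re_eval[OF t(3)]
    using maximalideal_kernel_of_surj_onto_field[OF hom field_from_type_algebra surj]
      ring_hom_ring.FactRing_iso[OF hom surj]
    by blast
qed

end
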